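(* Let $\alpha=\beta>0$. Then $z=0$ is a critical point of the density $f_{\alpha,\alpha}$, the function $s=s_{\alpha,\alpha}$ satisfies $$s(0)=0,\qquad s'(0)=-\frac14+\frac{1-\alpha}{\pi},$$ the second derivative $f_{\alpha,\alpha}''(0)$ has the same sign as $s'(0)$, and $s'(0)<0$ if and only if $\alpha>1-\frac{\pi}{4}$.
   Context: $\Phi$ and $\phi$ denote the standard normal cumulative distribution function and density, and $\mathrm{B}(\cdot,\cdot)$ is the beta function. For $\alpha,\beta>0$ the (standardized) beta normal density is $$f_{\alpha,\beta}(z)=\frac{1}{\mathrm{B}(\alpha,\beta)}\,\Phi(z)^{\alpha-1}\,[1-\Phi(z)]^{\beta-1}\,\phi(z),\qquad z\in\mathbb{R},$$ and $$s_{\alpha,\beta}(z)=(\alpha-1)\,\phi(z)\,[1-\Phi(z)]-(\beta-1)\,\phi(z)\,\Phi(z)-z\,\Phi(z)\,[1-\Phi(z)].$$ A critical point of $f_{\alpha,\beta}$ is a point where $f_{\alpha,\beta}'$ vanishes. Derivatives are with respect to $z$, and "same sign" means both positive, both negative, or both zero. *)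

theory Defs
  imports "HOL-Probability.Probability"
begin

abbreviation std_normal_cdf :: "real \<Rightarrow> real" where
  "std_normal_cdf \<equiv> cdf std_normal_distribution"

(* The powr convention at 0 is immaterial: the cdf takes values strictly between 0 and 1. *)
definition beta_normal_density :: "real \<Rightarrow> real \<Rightarrow> real \<Rightarrow> real" where
  "beta_normal_density \<alpha> \<beta> z =
     1 / Beta \<alpha> \<beta> * std_normal_cdf z powr (\<alpha> - 1) * (1 - std_normal_cdf z) powr (\<beta> - 1)
       * std_normal_density z"

definition beta_normal_s :: "real \<Rightarrow> real \<Rightarrow> real \<Rightarrow> real" where
  "beta_normal_s \<alpha> \<beta> z =
     (\<alpha> - 1) * std_normal_density z * (1 - std_normal_cdf z)
     - (\<beta> - 1) * std_normal_density z * std_normal_cdf z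
     - z * std_normal_cdf z * (1 - std_normal_cdf z)"

definition critical_point :: "(real \<Rightarrow> real) \<Rightarrow> real \<Rightarrow> bool" where
  "critical_point f z \<longleftrightarrow> (f has_real_derivative 0) (at z)"

definition same_sign :: "real \<Rightarrow> real \<Rightarrow> bool" where
  "same_sign x y \<longleftrightarrow> (0 < x \<and> 0 < y) \<or> (x < 0 \<and> y < 0) \<or> (x = 0 \<and> y = 0)"

end

theory Submission
  imports Defs
begin

text \<open>
  Differentiating the logarithm of the density shows that its derivative is
  \<open>f' = s * h\<close> with \<open>h = f / (\<Phi> * (1 - \<Phi>))\<close>, a positive function: the function \<open>s\<close> is the
  logarithmic derivative of \<open>f\<close> cleared of its denominators. Hence zeros of \<open>s\<close> are critical
  points, and at a zero of \<open>s\<close> the product rule leaves \<open>f'' = s' * h\<close>, which has the sign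
  of \<open>s'\<close>. This is \<open>beta_normal_density_has_derivative\<close>.

  For equal parameters, \<open>0\<close> is such a zero because \<open>\<Phi> 0 = 1/2\<close> makes the two density terms of
  \<open>s\<close> cancel. There \<open>\<phi>' = 0\<close>, so \<open>s' 0\<close> only involves \<open>\<Phi> 0\<close> and \<open>\<phi> 0 ^ 2 = 1 / (2 * pi)\<close>; this is
  \<open>beta_normal_s_has_derivative_0\<close>.

  Both steps rest on facts about \<open>\<Phi>\<close> as the distribution function of a measure: its
  derivative is \<open>\<phi>\<close> by the fundamental theorem of calculus; it lies strictly between \<open>0\<close> and \<open>1\<close>,
  so that all the powers are differentiable; and \<open>\<Phi> (- z) = 1 - \<Phi> z\<close>.
\<close>

lemma std_normal_density_deriv [derivative_intros]:
  assumes "(g has_real_derivative g') (at z within A)"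
  shows "((\<lambda>x. std_normal_density (g x)) has_real_derivative
     (- g z * std_normal_density (g z)) * g') (at z within A)"
proof -
  have "(std_normal_density has_real_derivative - y * std_normal_density y) (at y)" for y
    unfolding std_normal_density_def
    by (rule derivative_eq_intros refl | simp)+
  from DERIV_chain2[OF this assms] show ?thesis .
qed

text \<open>
  Starting the integral at a finite point \<open>a\<close> instead of minus infinity makes the fundamental
  theorem of calculus on compact intervals applicable to \<open>\<Phi>\<close>.
\<close>
lemma std_normal_cdf_eq_integral:
  assumes "a \<le> x"
  shows "std_normal_cdf x = std_normal_cdf a + integral {a..x} std_normal_density"
proof (cases "a < x")
  case True
  interpret N: real_distribution std_normal_distribution by (rule real_dist_normal_dist)
  have "std_normal_cdf x - std_normal_cdf a = measure std_normal_distribution {a<..x}"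
    using True by (rule N.cdf_diff_eq)
  also have "\<dots> = (LINT y|std_normal_distribution. indicator {a<..x} y)"
    by simp
  also have "\<dots> = (LINT y|lborel. std_normal_density y * indicator {a<..x} y)"
    by (subst integral_density) auto
  also have "\<dots> = (LINT y:{a<..x}|lborel. std_normal_density y)"
    by (simp add: set_lebesgue_integral_def mult.commute)
  also have "\<dots> = integral {a<..x} std_normal_density"
    by (rule set_borel_integral_eq_integral)
       (unfold set_integrable_def, intro integrable_mult_indicator integrable_normal_density,
        simp_all)
  also have "\<dots> = integral {a..x} std_normal_density"
    by (rule integral_subset_negligible [of _ "{a..x}"])
       (auto intro: negligible_subset[of "{a}"])
  finally show ?thesis by simp
qed (use assms in simp)

lemma std_normal_cdf_has_derivative:
  "(std_normal_cdf has_real_derivative std_normal_density z) (at z)"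
proof -
  \<comment> \<open>Any base point below \<open>z\<close> works: \<open>z\<close> has to be interior to the interval of integration
    for the derivative relative to that interval to be a full derivative.\<close>
  define a where "a = z - 1"
  have cont: "continuous_on A std_normal_density" for A
    unfolding std_normal_density_def by (intro continuous_intros) auto
  have "((\<lambda>x. std_normal_cdf a + integral {a..x} std_normal_density)
          has_real_derivative 0 + std_normal_density z) (at z within {a..z + 1})"
    by (intro DERIV_add DERIV_const integral_has_real_derivative cont) (auto simp: a_def)
  moreover have "at z within {a..z + 1} = at z"
    by (rule at_within_Icc_at) (auto simp: a_def)
  ultimately have "((\<lambda>x. std_normal_cdf a + integral {a..x} std_normal_density)
          has_real_derivative std_normal_density z) (at z)"
    by simp
  moreover have "\<forall>\<^sub>F x in nhds z.
      std_normal_cdf a + integral {a..x} std_normal_density = std_normal_cdf x"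
    by (rule eventually_mono[OF eventually_nhds_in_open[of "{a<..}"]])
       (auto simp: a_def intro: std_normal_cdf_eq_integral[symmetric])
  ultimately show ?thesis
    by (subst (asm) DERIV_cong_ev[OF refl _ refl]) assumption
qed

lemmas std_normal_cdf_deriv [derivative_intros] =
  DERIV_chain2[OF std_normal_cdf_has_derivative]

lemma std_normal_cdf_strict_mono: "x < y \<Longrightarrow> std_normal_cdf x < std_normal_cdf y"
  by (rule DERIV_pos_imp_increasing)
     (auto intro!: exI std_normal_cdf_has_derivative normal_density_pos)

lemma std_normal_cdf_pos: "0 < std_normal_cdf z"
proof -
  interpret N: real_distribution std_normal_distribution by (rule real_dist_normal_dist)
  have "0 \<le> std_normal_cdf (z - 1)" by (rule N.cdf_nonneg)
  also have "\<dots> < std_normal_cdf z" by (rule std_normal_cdf_strict_mono) simp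
  finally show ?thesis .
qed

lemma std_normal_cdf_less_1: "std_normal_cdf z < 1"
proof -
  interpret N: real_distribution std_normal_distribution by (rule real_dist_normal_dist)
  have "std_normal_cdf z < std_normal_cdf (z + 1)" by (rule std_normal_cdf_strict_mono) simp
  also have "\<dots> \<le> 1" by (rule N.cdf_bounded_prob)
  finally show ?thesis .
qed

text \<open>
  By evenness of the density, \<open>\<Phi> x + \<Phi> (- x)\<close> has derivative \<open>0\<close>; its constant value is its limit
  at infinity.
\<close>
lemma std_normal_cdf_minus: "std_normal_cdf (- z) = 1 - std_normal_cdf z"
proof -
  interpret N: real_distribution std_normal_distribution by (rule real_dist_normal_dist)
  define g where "g x = std_normal_cdf x + std_normal_cdf (- x)" for x
  have "(g has_real_derivative 0) (at x)" for x
    unfolding g_def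
    by (rule derivative_eq_intros refl)+ (simp add: std_normal_density_def)
  then have const: "g x = g z" for x
    by (rule DERIV_isconst_all[rule_format]) 
  have "(g \<longlongrightarrow> 1 + 0) at_top"
    unfolding g_def
    by (intro tendsto_add N.cdf_lim_at_top_prob
          filterlim_compose[OF N.cdf_lim_at_bot filterlim_uminus_at_bot_at_top])
  moreover have "(g \<longlongrightarrow> g z) at_top"
    by (rule tendsto_eventually) (rule always_eventually[OF allI], rule const)
  ultimately have "g z = 1"
    using tendsto_unique[of at_top g "1 + 0" "g z"] by simp
  then show ?thesis by (simp add: g_def)
qed

lemma std_normal_cdf_0: "std_normal_cdf 0 = 1 / 2"
  using std_normal_cdf_minus[of 0] by simp

text \<open>
  The factor next to \<open>s\<close> is positive for positive parameters, which is how \<open>s\<close> comes to carry all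
  the sign information about the derivative of the density.
\<close>
lemma beta_normal_density_has_derivative:
  "(beta_normal_density \<alpha> \<beta> has_real_derivative
     beta_normal_s \<alpha> \<beta> z *
       (beta_normal_density \<alpha> \<beta> z / (std_normal_cdf z * (1 - std_normal_cdf z)))) (at z)"
proof -
  have pos: "0 < std_normal_cdf z" "0 < 1 - std_normal_cdf z"
    using std_normal_cdf_pos std_normal_cdf_less_1 by simp_all
  \<comment> \<open>The exponent is kept at \<open>c\<close>, rather than lowered to \<open>c - 1\<close>, so that each term of the derivative
    of the density is a multiple of the density itself.\<close>
  have powr_deriv: "((\<lambda>x. g x powr c) has_real_derivative c * g z powr c * (g' / g z)) (at z)"
    if "(g has_real_derivative g') (at z)" "0 < g z" for g g' c
    using DERIV_powr[OF that DERIV_const[of c]] by (simp add: mult_ac)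
  have upper_tail: "((\<lambda>x. 1 - std_normal_cdf x) has_real_derivative - std_normal_density z) (at z)"
    using DERIV_diff[OF DERIV_const[of 1] std_normal_cdf_has_derivative] by simp
  define F G P Q d c where "F = std_normal_cdf z" and "G = 1 - F"
    and "P = F powr (\<alpha> - 1)" and "Q = G powr (\<beta> - 1)"
    and "d = std_normal_density z" and "c = 1 / Beta \<alpha> \<beta>"
  note defs = this
  have FG: "0 < F" "0 < G"
    using pos by (simp_all add: defs)
  have density: "beta_normal_density \<alpha> \<beta> z = c * P * Q * d"
    by (simp add: beta_normal_density_def defs)
  have s: "beta_normal_s \<alpha> \<beta> z = (\<alpha> - 1) * d * G - (\<beta> - 1) * d * F - z * F * G"
    by (simp add: beta_normal_s_def defs)
  have P': "((\<lambda>x. std_normal_cdf x powr (\<alpha> - 1)) has_real_derivative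
      (\<alpha> - 1) * P * (d / F)) (at z)"
    using powr_deriv[OF std_normal_cdf_has_derivative pos(1)] by (simp only: defs)
  have Q': "((\<lambda>x. (1 - std_normal_cdf x) powr (\<beta> - 1)) has_real_derivative
      (\<beta> - 1) * Q * (- d / G)) (at z)"
    using powr_deriv[OF upper_tail pos(2)] by (simp only: defs)
  have d': "(std_normal_density has_real_derivative - z * d) (at z)"
    using std_normal_density_deriv[OF DERIV_ident, of z] by (simp add: defs)
  have "(beta_normal_density \<alpha> \<beta> has_real_derivative
      (c * ((\<alpha> - 1) * P * (d / F)) * Q + (\<beta> - 1) * Q * (- d / G) * (c * P)) * d
        + - z * d * (c * P * Q)) (at z)"
    using DERIV_mult[OF DERIV_mult[OF DERIV_cmult[OF P', of c] Q'] d']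
    unfolding beta_normal_density_def[abs_def] by (simp only: defs)
  also have "(c * ((\<alpha> - 1) * P * (d / F)) * Q + (\<beta> - 1) * Q * (- d / G) * (c * P)) * d
        + - z * d * (c * P * Q) = (c * P * Q * d) * ((\<alpha> - 1) * d / F - (\<beta> - 1) * d / G - z)"
    by (simp add: algebra_simps add_divide_distrib diff_divide_distrib)
  also have "(\<alpha> - 1) * d / F - (\<beta> - 1) * d / G - z = beta_normal_s \<alpha> \<beta> z / (F * G)"
    using FG by (simp add: s diff_divide_distrib)
  finally show ?thesis
    by (simp add: density defs mult_ac)
qed

lemma beta_normal_s_has_derivative_0:
  "(beta_normal_s \<alpha> \<alpha> has_real_derivative - 1 / 4 + (1 - \<alpha>) / pi) (at 0)"
proof -
  have sq: "std_normal_density 0 * std_normal_density 0 = 1 / (2 * pi)"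
    by (simp add: std_normal_density_def)
  have "(beta_normal_s \<alpha> \<alpha> has_real_derivative
      - 1 / 4 - 2 * (\<alpha> - 1) * (std_normal_density 0 * std_normal_density 0)) (at 0)"
    unfolding beta_normal_s_def[abs_def]
    by (rule derivative_eq_intros refl)+ (simp add: std_normal_cdf_0 algebra_simps)
  also have "- 1 / 4 - 2 * (\<alpha> - 1) * (std_normal_density 0 * std_normal_density 0)
      = - 1 / 4 + (1 - \<alpha>) / pi"
    unfolding sq by (simp add: field_simps)
  finally show ?thesis .
qed

theorem mainTheorem4:
  fixes \<alpha> :: real and f s :: "real \<Rightarrow> real"
  defines "f \<equiv> beta_normal_density \<alpha> \<alpha>"
    and "s \<equiv> beta_normal_s \<alpha> \<alpha>"
  assumes "\<alpha> > 0"
  shows "critical_point f 0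
    \<and> s 0 = 0
    \<and> s differentiable (at 0)
    \<and> deriv s 0 = - 1 / 4 + (1 - \<alpha>) / pi
    \<and> (\<forall>\<^sub>F z in nhds 0. f differentiable (at z))
    \<and> deriv f differentiable (at 0)
    \<and> same_sign (deriv (deriv f) 0) (deriv s 0)
    \<and> (deriv s 0 < 0 \<longleftrightarrow> \<alpha> > 1 - pi / 4)"
proof -
  define h where "h z = f z / (std_normal_cdf z * (1 - std_normal_cdf z))" for z
  have s_0: "s 0 = 0"
    by (simp add: s_def beta_normal_s_def std_normal_cdf_0)
  have s': "(s has_real_derivative - 1 / 4 + (1 - \<alpha>) / pi) (at 0)"
    unfolding s_def by (rule beta_normal_s_has_derivative_0)
  then have s'_0: "deriv s 0 = - 1 / 4 + (1 - \<alpha>) / pi"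
    by (rule DERIV_imp_deriv)
  have f': "(f has_real_derivative s z * h z) (at z)" for z
    unfolding f_def s_def h_def by (rule beta_normal_density_has_derivative)
  then have deriv_f: "deriv f = (\<lambda>z. s z * h z)"
    by (auto intro: DERIV_imp_deriv)
  have "0 < f 0"
    using assms(3)
    by (simp add: f_def beta_normal_density_def std_normal_cdf_0 Beta_def normal_density_pos)
  then have h_pos: "0 < h 0"
    by (simp add: h_def std_normal_cdf_0)
  \<comment> \<open>Only the differentiability of \<open>h\<close> enters \<open>f''\<close>: the product rule for \<open>s * h\<close> multiplies
    this derivative by \<open>s 0 = 0\<close>.\<close>
  have "(h has_real_derivative
      (s 0 * h 0 * (1 / 4)
        - f 0 * (std_normal_density 0 * (1 - 1/2) - 1/2 * std_normal_density 0))
      / (1/4 * (1/4))) (at 0)"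
    unfolding h_def[abs_def]
    by (rule derivative_eq_intros f' refl | simp add: std_normal_cdf_0 h_def)+
  then have f'': "(deriv f has_real_derivative deriv s 0 * h 0) (at 0)"
    unfolding deriv_f by (auto intro!: derivative_eq_intros s' simp: s_0 s'_0)
  have "critical_point f 0"
    using f'[of 0] by (simp add: critical_point_def s_0)
  moreover have "same_sign (deriv (deriv f) 0) (deriv s 0)"
    using h_pos unfolding DERIV_imp_deriv[OF f''] same_sign_def
    by (auto simp: zero_less_mult_iff mult_less_0_iff not_less)
  moreover have "deriv s 0 < 0 \<longleftrightarrow> \<alpha> > 1 - pi / 4"
    unfolding s'_0 by (simp add: field_simps)
  ultimately show ?thesis
    using s_0 s' s'_0 f' f'' by (auto simp: real_differentiable_def intro!: always_eventually)
qed

end
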